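(* Let $\widehat{x}$ be an efficient solution of $(P)$. If the extended Abadie data qualification (EADQ) and the Maeda objective qualification (MOQ) hold at $\widehat{x}$, then $(P)$ satisfies the strong KKT condition at $\widehat{x}$.
   Context: Setting: $p\geq 2$, $I:=\{1,\ldots,p\}$; $f_i:\mathbb{R}^n\to\mathbb{R}$ ($i\in I$) are finite-valued convex functions; $T$ is an infinite index set; for each $t\in T$, $g_t:\mathbb{R}^n\to\mathbb{R}\cup\{+\infty\}$ is a lower semicontinuous proper convex function. Problem $(P)$: minimize $f(x):=(f_1(x),\ldots,f_p(x))$ subject to $g_t(x)\le 0$, $t\in T$, with feasible set $S:=\{x\in\mathbb{R}^n\mid g_t(x)\le 0\ \forall t\in T\}$ assumed nonempty. $\widehat{x}\in S$ is an efficient solution of $(P)$ if there is no $x\in S$ with $f_i(x)\le f_i(\widehat{x})$ for all $i\in I$ and $f(x)\neq f(\widehat{x})$. Notation: $\partial$ is the Fenchel–Moreau subdifferential; for nonempty $M\subseteq\mathbb{R}^n$, $M^{0}:=\{d\mid x'd\le 0\ \forall x\in M\}$ and $M^{-}:=\{d\mid x'd<0\ \forall x\in M\}$; for $\widehat{x}\in M$, $C(M,\widehat{x}):=\{v\mid\exists t_r\downarrow0,\ \exists v_r\to v:\ \widehat{x}+t_rv_r\in M\ \forall r\in\mathbb{N}\}$. $T(\widehat{x}):=\{t\in T\mid g_t(\widehat{x})=0\}$; $F(\widehat{x}):=\bigcup_{i=1}^p\partial f_i(\widehat{x})$; $G(\widehat{x}):=\bigcup_{t\in T(\widehat{x})}\partial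 g_t(\widehat{x})$; $F^{0}(\widehat{x}):=(F(\widehat{x}))^0$, $G^{0}(\widehat{x}):=(G(\widehat{x}))^0$; $Q^{i}(\widehat{x}):=\{x\in S\mid f_l(x)\le f_l(\widehat{x})\ \forall l\in I\setminus\{i\}\}$. EADQ holds at $\widehat{x}$ when $G(\widehat{x})\neq\emptyset$ and $F^{0}(\widehat{x})\cap G^{0}(\widehat{x})\subseteq\bigcap_{i=1}^{p}C(Q^{i}(\widehat{x}),\widehat{x})$. MOQ holds at $\widehat{x}$ when $F^{0}(\widehat{x})\subseteq\{0_n\}\cup\bigcup_{i=1}^{p}(\partial f_i(\widehat{x}))^{-}$. The strong KKT condition holds at $\widehat{x}\in S$ when there exist $\alpha_i>0$ ($i\in I$) with $\sum_{i=1}^p\alpha_i=1$, and $\beta_t\ge0$ ($t\in T(\widehat{x})$), with $\beta_t\neq0$ for finitely many indices only, such that $0_n\in\sum_{i=1}^p\alpha_i\partial f_i(\widehat{x})+\sum_{t\in T(\widehat{x})}\beta_t\partial g_t(\widehat{x})$. *)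

theory Defs
  imports "HOL-Analysis.Analysis"
begin

definition lsc :: "('a::topological_space \<Rightarrow> ereal) \<Rightarrow> bool" where
  "lsc h \<longleftrightarrow> (\<forall>x. h x \<le> Liminf (at x) h)"

text \<open>Proper: with values in \<open>\<real> \<union> {+\<infinity>}\<close> and finite somewhere.\<close>

definition proper :: "('a \<Rightarrow> ereal) \<Rightarrow> bool" where
  "proper h \<longleftrightarrow> (\<forall>x. h x \<noteq> -\<infinity>) \<and> (\<exists>x. h x \<noteq> \<infinity>)"

text \<open>Only meant for functions that never take the value \<open>-\<infinity>\<close>, so that the right-hand side
  is never of the form \<open>\<infinity> - \<infinity>\<close>.\<close>

definition convex_ereal :: "('a::real_vector \<Rightarrow> ereal) \<Rightarrow> bool" where
  "convex_ereal h \<longleftrightarrow> (\<forall>x y. \<forall>s::real. 0 < s \<longrightarrow> s < 1 \<longrightarrow>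
     h ((1 - s) *\<^sub>R x + s *\<^sub>R y) \<le> ereal (1 - s) * h x + ereal s * h y)"

text \<open>The Fenchel-Moreau subdifferential; it is empty at points where \<open>h\<close> is not finite.\<close>

definition subdiff :: "('a::real_inner \<Rightarrow> ereal) \<Rightarrow> 'a \<Rightarrow> 'a set" where
  "subdiff h x = {\<xi>. \<bar>h x\<bar> \<noteq> \<infinity> \<and> (\<forall>y. h y \<ge> h x + ereal (inner \<xi> (y - x)))}"

definition polar :: "('a::real_inner) set \<Rightarrow> 'a set" where
  "polar M = {d. \<forall>x\<in>M. inner x d \<le> 0}"

definition strict_polar :: "('a::real_inner) set \<Rightarrow> 'a set" where
  "strict_polar M = {d. \<forall>x\<in>M. inner x d < 0}"

definition contingent_cone :: "('a::real_normed_vector) set \<Rightarrow> 'a \<Rightarrow> 'a set" where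
  "contingent_cone M x = {v. \<exists>(s :: nat \<Rightarrow> real) w.
     filterlim s (at_right 0) sequentially \<and> (\<forall>r. s r > 0) \<and> w \<longlonglongrightarrow> v \<and>
     (\<forall>r. x + s r *\<^sub>R w r \<in> M)}"

text \<open>Below, the problem data are the number \<open>p\<close> of objectives \<open>f 1, \<dots>, f p\<close>, the index
  set \<open>T\<close> and the constraint functions \<open>g t\<close> for \<open>t \<in> T\<close>.\<close>

definition feasible :: "'t set \<Rightarrow> ('t \<Rightarrow> 'a \<Rightarrow> ereal) \<Rightarrow> 'a set" where
  "feasible T g = {x. \<forall>t\<in>T. g t x \<le> 0}"

definition efficient ::
  "nat \<Rightarrow> (nat \<Rightarrow> 'a \<Rightarrow> real) \<Rightarrow> 't set \<Rightarrow> ('t \<Rightarrow> 'a \<Rightarrow> ereal) \<Rightarrow> 'a \<Rightarrow> bool" where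
  "efficient p f T g xh \<longleftrightarrow> xh \<in> feasible T g \<and>
     \<not> (\<exists>x\<in>feasible T g. (\<forall>i\<in>{1..p}. f i x \<le> f i xh) \<and> (\<exists>i\<in>{1..p}. f i x \<noteq> f i xh))"

definition active :: "'t set \<Rightarrow> ('t \<Rightarrow> 'a \<Rightarrow> ereal) \<Rightarrow> 'a \<Rightarrow> 't set" where
  "active T g xh = {t\<in>T. g t xh = 0}"

abbreviation subdiff_real :: "('a::real_inner \<Rightarrow> real) \<Rightarrow> 'a \<Rightarrow> 'a set" where
  "subdiff_real h \<equiv> subdiff (\<lambda>y. ereal (h y))"

definition F_set :: "nat \<Rightarrow> (nat \<Rightarrow> 'a \<Rightarrow> real) \<Rightarrow> 'a \<Rightarrow> ('a::real_inner) set" where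
  "F_set p f xh = (\<Union>i\<in>{1..p}. subdiff_real (f i) xh)"

definition G_set :: "'t set \<Rightarrow> ('t \<Rightarrow> 'a \<Rightarrow> ereal) \<Rightarrow> 'a \<Rightarrow> ('a::real_inner) set" where
  "G_set T g xh = (\<Union>t\<in>active T g xh. subdiff (g t) xh)"

definition Q_set ::
  "nat \<Rightarrow> (nat \<Rightarrow> 'a \<Rightarrow> real) \<Rightarrow> 't set \<Rightarrow> ('t \<Rightarrow> 'a \<Rightarrow> ereal) \<Rightarrow> nat \<Rightarrow> 'a \<Rightarrow> 'a set" where
  "Q_set p f T g i xh = {x\<in>feasible T g. \<forall>l\<in>{1..p} - {i}. f l x \<le> f l xh}"

definition EADQ ::
  "nat \<Rightarrow> (nat \<Rightarrow> 'a \<Rightarrow> real) \<Rightarrow> 't set \<Rightarrow> ('t \<Rightarrow> 'a \<Rightarrow> ereal) \<Rightarrow> 'a::real_inner \<Rightarrow> bool" where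
  "EADQ p f T g xh \<longleftrightarrow> G_set T g xh \<noteq> {} \<and>
     polar (F_set p f xh) \<inter> polar (G_set T g xh)
       \<subseteq> (\<Inter>i\<in>{1..p}. contingent_cone (Q_set p f T g i xh) xh)"

definition MOQ :: "nat \<Rightarrow> (nat \<Rightarrow> 'a \<Rightarrow> real) \<Rightarrow> 'a::real_inner \<Rightarrow> bool" where
  "MOQ p f xh \<longleftrightarrow>
     polar (F_set p f xh) \<subseteq> {0} \<union> (\<Union>i\<in>{1..p}. strict_polar (subdiff_real (f i) xh))"

text \<open>The sums are Minkowski sums. The one over the active constraints runs over the finitely many
  indices with nonzero multiplier, so an empty subdifferential with multiplier zero contributes
  nothing.\<close>

definition strong_KKT ::
  "nat \<Rightarrow> (nat \<Rightarrow> 'a \<Rightarrow> real) \<Rightarrow> 't set \<Rightarrow> ('t \<Rightarrow> 'a \<Rightarrow> ereal) \<Rightarrow> 'a::real_inner \<Rightarrow> bool" where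
  "strong_KKT p f T g xh \<longleftrightarrow>
     (\<exists>(\<alpha> :: nat \<Rightarrow> real) (\<beta> :: 't \<Rightarrow> real).
        (\<forall>i\<in>{1..p}. \<alpha> i > 0) \<and> (\<Sum>i\<in>{1..p}. \<alpha> i) = 1 \<and>
        (\<forall>t\<in>active T g xh. \<beta> t \<ge> 0) \<and> finite {t\<in>active T g xh. \<beta> t \<noteq> 0} \<and>
        0 \<in> (\<Sum>i\<in>{1..p}. (*\<^sub>R) (\<alpha> i) ` subdiff_real (f i) xh)
          + (\<Sum>t\<in>{t\<in>active T g xh. \<beta> t \<noteq> 0}. (*\<^sub>R) (\<beta> t) ` subdiff (g t) xh))"

end

theory Submission
  imports Defs
begin

text \<open>Efficiency and the two qualifications together say that the sets \<open>F\<close> and \<open>G\<close> of subgradients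
  have only \<open>0\<close> in common in their polars (\<open>efficient_imp_polars_trivial\<close>): any other common
  element would be a direction in which one objective decreases to first order, and which can be
  followed feasibly without increasing the others.

  By separation, a convex cone in a finite-dimensional space with trivial polar is the whole space
  (\<open>family_cone_eq_UNIV\<close>). So the cone generated by \<open>F\<close> and \<open>G\<close> is everything, although nothing is
  known about the closedness of the cone generated by the infinite family of constraints. In
  particular it contains \<open>- (\<Sum>i\<in>{1..p}. u i)\<close> for arbitrary subgradients \<open>u i\<close> of the objectives.
  Moving this sum to the other side gives a vanishing combination in which every objective has a
  coefficient of at least one, and normalizing it yields the strong KKT condition
  (\<open>family_cone_UNIV_imp_strong_KKT\<close>).

  The link between subgradients and descent is \<open>strict_polar_subdiff_imp_descent\<close>, which rests on
  the existence of subgradients of a finite convex function and on the stability of subgradients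
  under limits.\<close>

section \<open>Subgradients of finite convex functions\<close>

lemma subdiff_real_iff:
  "\<xi> \<in> subdiff_real h x \<longleftrightarrow> (\<forall>y. h x + inner \<xi> (y - x) \<le> h y)"
  by (simp add: subdiff_def)

lemma convex_subdiff: "convex (subdiff h x)"
proof (rule convexI)
  fix \<xi> \<eta> and u v :: real
  assume \<xi>: "\<xi> \<in> subdiff h x" and \<eta>: "\<eta> \<in> subdiff h x"
    and uv: "0 \<le> u" "0 \<le> v" "u + v = 1"
  from \<xi> obtain c where c: "h x = ereal c"
    by (auto simp: subdiff_def)
  have "h x + ereal (inner (u *\<^sub>R \<xi> + v *\<^sub>R \<eta>) (y - x)) \<le> h y" for y
  proof (cases "h y")
    case (real b)
    have *: "c + inner \<xi> (y - x) \<le> b" "c + inner \<eta> (y - x) \<le> b"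
      using \<xi> \<eta> c real by (auto simp: subdiff_def dest!: spec[of _ y])
    have "u * (c + inner \<xi> (y - x)) + v * (c + inner \<eta> (y - x)) \<le> b"
      using convex_bound_le[OF * uv] .
    moreover have "u * (c + inner \<xi> (y - x)) + v * (c + inner \<eta> (y - x))
        = (u + v) * c + inner (u *\<^sub>R \<xi> + v *\<^sub>R \<eta>) (y - x)"
      by (simp add: algebra_simps)
    ultimately show ?thesis
      using c real uv by simp
  next
    case MInf
    have "h x + ereal (inner \<xi> (y - x)) \<le> h y"
      using \<xi> by (simp add: subdiff_def)
    then show ?thesis
      using c MInf by simp
  qed simp
  then show "u *\<^sub>R \<xi> + v *\<^sub>R \<eta> \<in> subdiff h x"
    using c by (simp add: subdiff_def)
qed

text \<open>The point \<open>(x, f x)\<close> lies outside the convex strict epigraph of \<open>f\<close>, so a hyperplane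
  separates them. That hyperplane is not vertical because \<open>f\<close> is finite on the whole space, and its
  slope is then a subgradient.\<close>

lemma subdiff_real_nonempty:
  fixes f :: "'a::euclidean_space \<Rightarrow> real"
  assumes f: "convex_on UNIV f"
  shows "subdiff_real f x \<noteq> {}"
proof -
  define E where "E = {(y, t). f y < t}"
  have "convex E"
  proof (rule convexI)
    fix a b :: "'a \<times> real" and u v :: real
    assume ab: "a \<in> E" "b \<in> E" and uv: "0 \<le> u" "0 \<le> v" "u + v = 1"
    have "f (u *\<^sub>R fst a + v *\<^sub>R fst b) \<le> u * f (fst a) + v * f (fst b)"
      using f uv by (simp add: convex_on_def)
    also have "\<dots> < u * snd a + v * snd b"
    proof (cases "u = 0")
      case True
      then show ?thesis using ab uv by (auto simp: E_def)
    next
      case False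
      then show ?thesis using ab uv
        by (intro add_less_le_mono mult_strict_left_mono mult_left_mono) (auto simp: E_def)
    qed
    finally show "u *\<^sub>R a + v *\<^sub>R b \<in> E"
      by (simp add: E_def case_prod_beta)
  qed
  moreover have "(x, f x + 1) \<in> E" and "(x, f x) \<notin> E"
    by (auto simp: E_def)
  ultimately have "\<exists>a b. a \<noteq> 0 \<and> (\<forall>z\<in>{(x, f x)}. inner a z \<le> b) \<and> (\<forall>z\<in>E. b \<le> inner a z)"
    by (intro separating_hyperplane_sets) auto
  then obtain a b where a: "a \<noteq> 0" "inner a (x, f x) \<le> b" "\<forall>z\<in>E. b \<le> inner a z"
    by blast
  obtain u s where us: "a = (u, s)" by fastforce
  have sep: "inner u x + s * f x \<le> inner u y + s * t" if "f y < t" for y t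
  proof -
    have "(y, t) \<in> E" using that by (simp add: E_def)
    with a(2,3) us show ?thesis by (fastforce simp: inner_prod_def)
  qed
  have "s \<ge> 0"
    using sep[of x "f x + 1"] by (simp add: algebra_simps)
  moreover have "s \<noteq> 0"
  proof
    assume "s = 0"
    with sep[of "x - u" "f (x - u) + 1"] have "inner u u \<le> 0"
      by (simp add: inner_diff_right)
    then have "u = 0" by (metis inner_gt_zero_iff not_le)
    with \<open>s = 0\<close> us a(1) show False by (simp add: zero_prod_def)
  qed
  ultimately have s: "s > 0" by simp
  have "f x + inner (- (1 / s) *\<^sub>R u) (y - x) \<le> f y" for y
  proof (rule dense_ge)
    fix t assume "f y < t"
    from sep[OF this] s show "f x + inner (- (1 / s) *\<^sub>R u) (y - x) \<le> t"
      by (simp add: inner_diff_right field_simps)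
  qed
  then have "- (1 / s) *\<^sub>R u \<in> subdiff_real f x"
    unfolding subdiff_real_iff by blast
  then show ?thesis by blast
qed

text \<open>The compactness and closedness of the subdifferential in one statement. A unit step from
  \<open>y n\<close> in the direction of \<open>\<xi> n\<close> raises \<open>f\<close> by at least \<open>norm (\<xi> n)\<close>, so boundedness of \<open>f\<close>
  on bounded sets bounds the subgradients; continuity of \<open>f\<close> passes the subgradient inequality to
  the limit.\<close>

lemma subgradients_convergent_subsequence:
  fixes f :: "'a::euclidean_space \<Rightarrow> real"
  assumes f: "convex_on UNIV f" and y: "y \<longlonglongrightarrow> x"
    and \<xi>: "\<And>n. \<xi> n \<in> subdiff_real f (y n)"
  obtains \<zeta> \<sigma> where "\<zeta> \<in> subdiff_real f x" "strict_mono (\<sigma> :: nat \<Rightarrow> nat)"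
    "(\<lambda>n. \<xi> (\<sigma> n)) \<longlonglongrightarrow> \<zeta>"
proof -
  have cont: "continuous_on UNIV f"
    using convex_on_continuous[of UNIV f] f by simp
  obtain R where R: "\<And>n. norm (y n) \<le> R"
    using convergent_imp_bounded[OF y] by (auto simp: bounded_iff)
  have "bounded (f ` cball 0 (R + 1))"
    by (intro compact_imp_bounded compact_continuous_image continuous_on_subset[OF cont]) auto
  then obtain M where M: "\<And>z. norm z \<le> R + 1 \<Longrightarrow> \<bar>f z\<bar> \<le> M"
    unfolding bounded_iff by (metis image_eqI mem_cball_0 real_norm_def)
  have "norm (\<xi> n) \<le> 2 * M" for n
  proof -
    have "norm (y n + sgn (\<xi> n)) \<le> R + 1"
      using norm_triangle_ineq[of "y n" "sgn (\<xi> n)"] R[of n] by (auto simp: norm_sgn split: if_splits)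
    then have "\<bar>f (y n + sgn (\<xi> n))\<bar> \<le> M" by (rule M)
    moreover have "\<bar>f (y n)\<bar> \<le> M" using R[of n] by (intro M) simp
    moreover have "f (y n) + inner (\<xi> n) (sgn (\<xi> n)) \<le> f (y n + sgn (\<xi> n))"
      using \<xi>[of n] unfolding subdiff_real_iff by (metis add_diff_cancel_left')
    moreover have "inner (\<xi> n) (sgn (\<xi> n)) = norm (\<xi> n)"
      by (cases "\<xi> n = 0")
        (simp_all add: sgn_div_norm power2_norm_eq_inner[symmetric] power2_eq_square)
    ultimately show ?thesis by linarith
  qed
  then have "bounded (range \<xi>)" by (auto simp: bounded_iff)
  then obtain \<zeta> \<sigma> where \<sigma>: "strict_mono (\<sigma> :: nat \<Rightarrow> nat)" and lim: "(\<xi> \<circ> \<sigma>) \<longlonglongrightarrow> \<zeta>"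
    using bounded_imp_convergent_subsequence by blast
  have lim': "(\<lambda>n. \<xi> (\<sigma> n)) \<longlonglongrightarrow> \<zeta>" using lim by (simp add: o_def)
  have ylim: "(\<lambda>n. y (\<sigma> n)) \<longlonglongrightarrow> x"
    using LIMSEQ_subseq_LIMSEQ[OF y \<sigma>] by (simp add: o_def)
  have flim: "(\<lambda>n. f (y (\<sigma> n))) \<longlonglongrightarrow> f x"
    using continuous_on_tendsto_compose[OF cont ylim] by simp
  have "f x + inner \<zeta> (z - x) \<le> f z" for z
  proof (rule LIMSEQ_le_const2)
    show "(\<lambda>n. f (y (\<sigma> n)) + inner (\<xi> (\<sigma> n)) (z - y (\<sigma> n))) \<longlonglongrightarrow> f x + inner \<zeta> (z - x)"
      by (intro tendsto_intros flim lim' ylim)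
    show "\<exists>N. \<forall>n\<ge>N. f (y (\<sigma> n)) + inner (\<xi> (\<sigma> n)) (z - y (\<sigma> n)) \<le> f z"
      using \<xi> unfolding subdiff_real_iff by blast
  qed
  then have "\<zeta> \<in> subdiff_real f x" unfolding subdiff_real_iff by blast
  with \<sigma> lim' that show ?thesis by blast
qed

text \<open>If \<open>f\<close> failed to decrease at infinitely many of the points \<open>x + s r *\<^sub>R w r\<close>, subgradients
  there would have nonnegative inner product with \<open>w r\<close>, and a limit of them would be a subgradient
  at \<open>x\<close> with nonnegative inner product with \<open>d\<close>.\<close>

lemma strict_polar_subdiff_imp_descent:
  fixes f :: "'a::euclidean_space \<Rightarrow> real"
  assumes f: "convex_on UNIV f" and d: "d \<in> strict_polar (subdiff_real f x)"
    and s: "filterlim s (at_right 0) sequentially" and spos: "\<And>r. s r > 0"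
    and w: "w \<longlonglongrightarrow> d"
  shows "eventually (\<lambda>r. f (x + s r *\<^sub>R w r) < f x) sequentially"
proof (rule ccontr)
  assume "\<not> ?thesis"
  then obtain \<phi> where \<phi>: "strict_mono (\<phi> :: nat \<Rightarrow> nat)"
    and no: "\<And>n. f x \<le> f (x + s (\<phi> n) *\<^sub>R w (\<phi> n))"
    using not_eventually_sequentiallyD[of "\<lambda>r. f (x + s r *\<^sub>R w r) < f x"]
    by (auto simp: not_less)
  define y where "y n = x + s (\<phi> n) *\<^sub>R w (\<phi> n)" for n
  have "s \<longlonglongrightarrow> 0"
    using s by (simp add: filterlim_at)
  then have slim: "(\<lambda>n. s (\<phi> n)) \<longlonglongrightarrow> 0"
    using LIMSEQ_subseq_LIMSEQ[OF _ \<phi>] by (auto simp: o_def)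
  have wlim: "(\<lambda>n. w (\<phi> n)) \<longlonglongrightarrow> d"
    using LIMSEQ_subseq_LIMSEQ[OF w \<phi>] by (simp add: o_def)
  have "y \<longlonglongrightarrow> x + 0 *\<^sub>R d"
    unfolding y_def by (intro tendsto_intros slim wlim)
  then have ylim: "y \<longlonglongrightarrow> x" by simp
  have "\<exists>\<xi>. \<forall>n. \<xi> n \<in> subdiff_real f (y n)"
    using subdiff_real_nonempty[OF f] by (intro choice allI) blast
  then obtain \<xi> where \<xi>: "\<And>n. \<xi> n \<in> subdiff_real f (y n)" by blast
  have pos: "0 \<le> inner (\<xi> n) (w (\<phi> n))" for n
  proof -
    have "f (y n) + inner (\<xi> n) (x - y n) \<le> f x"
      using \<xi>[of n] unfolding subdiff_real_iff by blast
    then have "0 \<le> s (\<phi> n) * inner (\<xi> n) (w (\<phi> n))"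
      using no[of n] by (simp add: y_def)
    then show ?thesis using spos[of "\<phi> n"] by (simp add: zero_le_mult_iff)
  qed
  obtain \<zeta> \<sigma> where \<zeta>: "\<zeta> \<in> subdiff_real f x" and \<sigma>: "strict_mono (\<sigma> :: nat \<Rightarrow> nat)"
    and lim: "(\<lambda>n. \<xi> (\<sigma> n)) \<longlonglongrightarrow> \<zeta>"
    using subgradients_convergent_subsequence[OF f ylim \<xi>] by blast
  have "(\<lambda>n. inner (\<xi> (\<sigma> n)) (w (\<phi> (\<sigma> n)))) \<longlonglongrightarrow> inner \<zeta> d"
    using LIMSEQ_subseq_LIMSEQ[OF wlim \<sigma>] by (intro tendsto_inner lim) (simp add: o_def)
  then have "0 \<le> inner \<zeta> d"
    using pos by (intro LIMSEQ_le_const) auto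
  with d \<zeta> show False by (force simp: strict_polar_def)
qed

section \<open>The convex cone generated by a family of convex sets\<close>

text \<open>At most one vector is taken from each member of the family. For convex members this is the
  convex cone generated by their union, in the shape in which multipliers appear in optimality
  conditions. A member with coefficient zero may be empty.\<close>

definition family_cone :: "('j \<Rightarrow> 'a::real_vector set) \<Rightarrow> 'j set \<Rightarrow> 'a set" where
  "family_cone A J = {x. \<exists>c v. (\<forall>j\<in>J. 0 \<le> c j) \<and> finite {j\<in>J. c j \<noteq> 0} \<and>
     (\<forall>j\<in>J. c j \<noteq> 0 \<longrightarrow> v j \<in> A j) \<and> x = (\<Sum>j\<in>{j\<in>J. c j \<noteq> 0}. c j *\<^sub>R v j)}"

lemma convex_combine_scaled:
  fixes A :: "'a::real_vector set" and a b :: real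
  assumes "convex A" "0 \<le> a" "0 \<le> b" "a + b \<noteq> 0"
    and "a \<noteq> 0 \<Longrightarrow> u \<in> A" "b \<noteq> 0 \<Longrightarrow> v \<in> A"
  shows "\<exists>w\<in>A. (a + b) *\<^sub>R w = a *\<^sub>R u + b *\<^sub>R v"
proof (cases "a = 0 \<or> b = 0")
  case True
  then show ?thesis using assms by auto
next
  case False
  have "(a / (a + b)) *\<^sub>R u + (b / (a + b)) *\<^sub>R v \<in> A"
    using assms False by (intro convexD) (auto simp: add_divide_distrib[symmetric])
  moreover have "(a + b) *\<^sub>R ((a / (a + b)) *\<^sub>R u + (b / (a + b)) *\<^sub>R v) = a *\<^sub>R u + b *\<^sub>R v"
    using assms(4) by (simp add: scaleR_add_right)
  ultimately show ?thesis by blast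
qed

lemma zero_in_family_cone: "0 \<in> family_cone A J"
  unfolding family_cone_def by (auto intro!: exI[of _ "\<lambda>_. 0"])

lemma member_in_family_cone:
  assumes "j \<in> J" "x \<in> A j"
  shows "x \<in> family_cone A J"
proof -
  have "{i \<in> J. (if i = j then 1 else 0 :: real) \<noteq> 0} = {j}"
    using assms by auto
  then show ?thesis
    unfolding family_cone_def using assms
    by (auto intro!: exI[of _ "\<lambda>i. if i = j then 1 else 0"] exI[of _ "\<lambda>_. x"])
qed

lemma family_cone_scaleR:
  assumes "x \<in> family_cone A J" "0 \<le> a"
  shows "a *\<^sub>R x \<in> family_cone A J"
proof (cases "a = 0")
  case True
  then show ?thesis by (simp add: zero_in_family_cone)
next
  case False
  from assms(1) obtain c v where cv: "\<forall>j\<in>J. 0 \<le> c j" "finite {j\<in>J. c j \<noteq> 0}"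
    "\<forall>j\<in>J. c j \<noteq> 0 \<longrightarrow> v j \<in> A j" "x = (\<Sum>j\<in>{j\<in>J. c j \<noteq> 0}. c j *\<^sub>R v j)"
    unfolding family_cone_def by blast
  then show ?thesis
    unfolding family_cone_def using assms(2) False
    by (auto intro!: exI[of _ "\<lambda>j. a * c j"] exI[of _ v] simp: scaleR_sum_right)
qed

lemma family_cone_add:
  assumes conv: "\<And>j. j \<in> J \<Longrightarrow> convex (A j)"
    and x: "x \<in> family_cone A J" and y: "y \<in> family_cone A J"
  shows "x + y \<in> family_cone A J"
proof -
  from x obtain c v where c: "\<forall>j\<in>J. 0 \<le> c j" "finite {j\<in>J. c j \<noteq> 0}"
    "\<forall>j\<in>J. c j \<noteq> 0 \<longrightarrow> v j \<in> A j" "x = (\<Sum>j\<in>{j\<in>J. c j \<noteq> 0}. c j *\<^sub>R v j)"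
    unfolding family_cone_def by blast
  from y obtain c' v' where c': "\<forall>j\<in>J. 0 \<le> c' j" "finite {j\<in>J. c' j \<noteq> 0}"
    "\<forall>j\<in>J. c' j \<noteq> 0 \<longrightarrow> v' j \<in> A j" "y = (\<Sum>j\<in>{j\<in>J. c' j \<noteq> 0}. c' j *\<^sub>R v' j)"
    unfolding family_cone_def by blast
  define B where "B = {j\<in>J. c j + c' j \<noteq> 0}"
  have B: "B = {j\<in>J. c j \<noteq> 0} \<union> {j\<in>J. c' j \<noteq> 0}"
    using c(1) c'(1) by (auto simp: B_def add_nonneg_eq_0_iff)
  then have fin: "finite B" using c(2) c'(2) by simp
  have "\<forall>j\<in>B. \<exists>w\<in>A j. (c j + c' j) *\<^sub>R w = c j *\<^sub>R v j + c' j *\<^sub>R v' j"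
    using conv c(1,3) c'(1,3) by (intro ballI convex_combine_scaled) (auto simp: B_def)
  then obtain w where w: "\<And>j. j \<in> B \<Longrightarrow> w j \<in> A j"
      "\<And>j. j \<in> B \<Longrightarrow> (c j + c' j) *\<^sub>R w j = c j *\<^sub>R v j + c' j *\<^sub>R v' j"
    by metis
  have "x = (\<Sum>j\<in>B. c j *\<^sub>R v j)" "y = (\<Sum>j\<in>B. c' j *\<^sub>R v' j)"
    unfolding c(4) c'(4) using fin B by (auto intro!: sum.mono_neutral_left)
  then have "x + y = (\<Sum>j\<in>B. (c j + c' j) *\<^sub>R w j)"
    by (simp add: w(2) sum.distrib)
  with fin w(1) c(1) c'(1) show ?thesis
    unfolding family_cone_def B_def
    by (auto intro!: exI[of _ "\<lambda>j. c j + c' j"] exI[of _ w])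
qed

text \<open>A point outside the cone could be separated from it by a hyperplane, and since the cone is
  closed under positive scaling the normal of that hyperplane would be a nonzero vector in the
  polar. In finite dimension a point and a convex set can be weakly separated even if the point
  lies in the closure of the set, which is essential because a cone generated by infinitely many
  sets is rarely closed.\<close>

lemma family_cone_eq_UNIV:
  fixes A :: "'j \<Rightarrow> 'a::euclidean_space set"
  assumes conv: "\<And>j. j \<in> J \<Longrightarrow> convex (A j)"
    and pol: "polar (\<Union>j\<in>J. A j) \<subseteq> {0}"
  shows "family_cone A J = UNIV"
proof (rule ccontr)
  assume "family_cone A J \<noteq> UNIV"
  then obtain z where z: "z \<notin> family_cone A J" by blast
  have "convex (family_cone A J)"
    by (intro convexI family_cone_add conv family_cone_scaleR)
  then obtain a b where a: "a \<noteq> 0" "\<forall>x\<in>family_cone A J. inner a x \<le> b"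
    using separating_hyperplane_sets[of "family_cone A J" "{z}"] z zero_in_family_cone by blast
  have "inner x a \<le> 0" if "j \<in> J" "x \<in> A j" for j x
  proof (rule ccontr)
    assume "\<not> inner x a \<le> 0"
    then have pos: "0 < inner a x" by (simp add: inner_commute)
    have "0 \<le> b" using a(2) zero_in_family_cone[of A J] by fastforce
    \<comment> \<open>The multiple of \<open>x\<close> on which the functional takes the value \<open>b + 1\<close>.\<close>
    with pos have "((b + 1) / inner a x) *\<^sub>R x \<in> family_cone A J"
      using member_in_family_cone[of j J x A] that by (intro family_cone_scaleR) auto
    with a(2) have "inner a (((b + 1) / inner a x) *\<^sub>R x) \<le> b" by blast
    with pos show False by simp
  qed
  then have "a \<in> polar (\<Union>j\<in>J. A j)" by (auto simp: polar_def)
  with pol a(1) show False by blast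
qed

section \<open>Efficiency and the multipliers\<close>

text \<open>A nonzero \<open>d\<close> in both polars would, by the objective qualification, be a strict descent
  direction of some \<open>f i\<close>, while the data qualification approximates \<open>d\<close> by feasible steps that do
  not increase the other objectives. Such a step dominates \<open>xh\<close>.\<close>

lemma efficient_imp_polars_trivial:
  fixes f :: "nat \<Rightarrow> 'a::euclidean_space \<Rightarrow> real"
  assumes conv: "\<And>i. i \<in> {1..p} \<Longrightarrow> convex_on UNIV (f i)"
    and eff: "efficient p f T g xh" and eadq: "EADQ p f T g xh" and moq: "MOQ p f xh"
  shows "polar (F_set p f xh) \<inter> polar (G_set T g xh) \<subseteq> {0}"
proof (rule ccontr)
  assume "\<not> ?thesis"
  then obtain d where d: "d \<in> polar (F_set p f xh)" "d \<in> polar (G_set T g xh)" "d \<noteq> 0" by blast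
  from d(1,3) moq obtain i where i: "i \<in> {1..p}" "d \<in> strict_polar (subdiff_real (f i) xh)"
    unfolding MOQ_def by blast
  have "d \<in> contingent_cone (Q_set p f T g i xh) xh"
    using eadq d(1,2) i(1) unfolding EADQ_def by blast
  then obtain s w where s: "filterlim s (at_right 0) sequentially" "\<And>r. s r > 0"
    and w: "w \<longlonglongrightarrow> d" and Q: "\<And>r. xh + s r *\<^sub>R w r \<in> Q_set p f T g i xh"
    unfolding contingent_cone_def by blast
  obtain r where "f i (xh + s r *\<^sub>R w r) < f i xh"
    using strict_polar_subdiff_imp_descent[OF conv[OF i(1)] i(2) s w]
    by (auto simp: eventually_sequentially)
  moreover have "f l (xh + s r *\<^sub>R w r) \<le> f l xh" if "l \<in> {1..p}" "l \<noteq> i" for l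
    using Q[of r] that by (simp add: Q_set_def)
  ultimately have "\<forall>l\<in>{1..p}. f l (xh + s r *\<^sub>R w r) \<le> f l xh"
    and "f i (xh + s r *\<^sub>R w r) \<noteq> f i xh"
    by (metis less_imp_le, simp)
  moreover have "xh + s r *\<^sub>R w r \<in> feasible T g"
    using Q[of r] by (simp add: Q_set_def)
  ultimately show False
    using eff i(1) unfolding efficient_def by blast
qed

lemma sum_in_set_sum:
  assumes "finite I" "\<And>i. i \<in> I \<Longrightarrow> x i \<in> X i"
  shows "sum x I \<in> sum X I"
  using assms by (auto simp: set_sum_alt)

text \<open>Expressing minus a sum of subgradients, one from each objective, in the cone forces the
  coefficient of every objective to be at least one before normalization. This is what makes all
  multipliers of the objectives positive.\<close>

lemma family_cone_UNIV_imp_strong_KKT: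
  fixes f :: "nat \<Rightarrow> 'a::real_inner \<Rightarrow> real"
  assumes p: "1 \<le> p"
    and ne: "\<And>i. i \<in> {1..p} \<Longrightarrow> subdiff_real (f i) xh \<noteq> {}"
    and cone: "family_cone (case_sum (\<lambda>i. subdiff_real (f i) xh) (\<lambda>t. subdiff (g t) xh))
      ({1..p} <+> active T g xh) = UNIV"
  shows "strong_KKT p f T g xh"
proof -
  let ?A = "case_sum (\<lambda>i. subdiff_real (f i) xh) (\<lambda>t. subdiff (g t) xh)"
  let ?J = "{1..p} <+> active T g xh"
  obtain u where u: "\<And>i. i \<in> {1..p} \<Longrightarrow> u i \<in> subdiff_real (f i) xh"
    using bchoice[of "{1..p}" "\<lambda>i \<xi>. \<xi> \<in> subdiff_real (f i) xh"] ne by blast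
  have "- (\<Sum>i\<in>{1..p}. u i) \<in> family_cone ?A ?J" using cone by simp
  then obtain c v where c: "\<forall>j\<in>?J. 0 \<le> c j" "finite {j\<in>?J. c j \<noteq> 0}"
    "\<forall>j\<in>?J. c j \<noteq> 0 \<longrightarrow> v j \<in> ?A j"
    "- (\<Sum>i\<in>{1..p}. u i) = (\<Sum>j\<in>{j\<in>?J. c j \<noteq> 0}. c j *\<^sub>R v j)"
    unfolding family_cone_def by blast
  define a where "a i = c (Inl i)" for i
  define b where "b t = c (Inr t)" for t
  define B where "B = {t\<in>active T g xh. b t \<noteq> 0}"
  have a0: "0 \<le> a i" if "i \<in> {1..p}" for i using c(1) that by (auto simp: a_def)
  have b0: "0 \<le> b t" if "t \<in> active T g xh" for t using c(1) that by (auto simp: b_def)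
  have supp: "{j\<in>?J. c j \<noteq> 0} = {i\<in>{1..p}. a i \<noteq> 0} <+> B"
    by (auto simp: a_def b_def B_def)
  have finB: "finite B"
    using c(2) unfolding supp by (rule finite_PlusD)
  have "- (\<Sum>i\<in>{1..p}. u i)
      = (\<Sum>i\<in>{i\<in>{1..p}. a i \<noteq> 0}. a i *\<^sub>R v (Inl i)) + (\<Sum>t\<in>B. b t *\<^sub>R v (Inr t))"
    using finB unfolding c(4) supp by (simp add: sum.Plus a_def b_def)
  also have "(\<Sum>i\<in>{i\<in>{1..p}. a i \<noteq> 0}. a i *\<^sub>R v (Inl i)) = (\<Sum>i\<in>{1..p}. a i *\<^sub>R v (Inl i))"
    by (intro sum.mono_neutral_left) auto
  finally have zero: "(\<Sum>i\<in>{1..p}. u i + a i *\<^sub>R v (Inl i)) + (\<Sum>t\<in>B. b t *\<^sub>R v (Inr t)) = 0"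
    by (simp add: sum.distrib algebra_simps neg_eq_iff_add_eq_0)
  \<comment> \<open>Each objective contributes two subgradients here, while the strong KKT condition allows only
    one; convexity of the subdifferential merges them.\<close>
  have "\<exists>w\<in>subdiff_real (f i) xh. (1 + a i) *\<^sub>R w = 1 *\<^sub>R u i + a i *\<^sub>R v (Inl i)"
    if i: "i \<in> {1..p}" for i
    using a0[OF i] u[OF i] c(3) i
    by (intro convex_combine_scaled convex_subdiff) (auto simp: a_def)
  then obtain w where w: "\<And>i. i \<in> {1..p} \<Longrightarrow> w i \<in> subdiff_real (f i) xh"
      "\<And>i. i \<in> {1..p} \<Longrightarrow> (1 + a i) *\<^sub>R w i = u i + a i *\<^sub>R v (Inl i)"
    by (metis scaleR_one)
  define S where "S = (\<Sum>i\<in>{1..p}. 1 + a i)"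
  have S: "S > 0"
    unfolding S_def using p a0 by (intro sum_pos) (auto intro!: add_pos_nonneg)
  define \<alpha> where "\<alpha> i = (1 + a i) / S" for i
  define \<beta> where "\<beta> t = b t / S" for t
  have supp_\<beta>: "{t\<in>active T g xh. \<beta> t \<noteq> 0} = B"
    using S by (auto simp: \<beta>_def B_def)
  have "(\<Sum>i\<in>{1..p}. \<alpha> i *\<^sub>R w i) + (\<Sum>t\<in>B. \<beta> t *\<^sub>R v (Inr t))
      = (1 / S) *\<^sub>R ((\<Sum>i\<in>{1..p}. (1 + a i) *\<^sub>R w i) + (\<Sum>t\<in>B. b t *\<^sub>R v (Inr t)))"
    by (simp add: \<alpha>_def \<beta>_def scaleR_add_right scaleR_sum_right)
  also have "\<dots> = 0"
    using zero w(2) by simp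
  finally have eq: "(\<Sum>i\<in>{1..p}. \<alpha> i *\<^sub>R w i) + (\<Sum>t\<in>B. \<beta> t *\<^sub>R v (Inr t)) = 0" .
  have v_sub: "v (Inr t) \<in> subdiff (g t) xh" if "t \<in> B" for t
    using bspec[OF c(3), of "Inr t"] that by (auto simp: B_def b_def)
  have "(\<Sum>i\<in>{1..p}. \<alpha> i *\<^sub>R w i) \<in> (\<Sum>i\<in>{1..p}. (*\<^sub>R) (\<alpha> i) ` subdiff_real (f i) xh)"
    using w(1) by (intro sum_in_set_sum) auto
  moreover have "(\<Sum>t\<in>B. \<beta> t *\<^sub>R v (Inr t)) \<in> (\<Sum>t\<in>B. (*\<^sub>R) (\<beta> t) ` subdiff (g t) xh)"
    using finB v_sub by (intro sum_in_set_sum) auto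
  ultimately have "0 \<in> (\<Sum>i\<in>{1..p}. (*\<^sub>R) (\<alpha> i) ` subdiff_real (f i) xh)
      + (\<Sum>t\<in>B. (*\<^sub>R) (\<beta> t) ` subdiff (g t) xh)"
    unfolding eq[symmetric] by (rule set_plus_intro)
  moreover have "\<forall>i\<in>{1..p}. \<alpha> i > 0"
    using S a0 by (auto simp: \<alpha>_def intro!: divide_pos_pos add_pos_nonneg)
  moreover have "(\<Sum>i\<in>{1..p}. \<alpha> i) = 1"
    using S unfolding \<alpha>_def sum_divide_distrib[symmetric] S_def[symmetric] by simp
  moreover have "\<forall>t\<in>active T g xh. \<beta> t \<ge> 0"
    using S b0 by (simp add: \<beta>_def)
  ultimately show ?thesis
    unfolding strong_KKT_def using finB
    by (intro exI[of _ \<alpha>] exI[of _ \<beta>] conjI) (simp_all only: supp_\<beta>)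
qed

section \<open>Strong KKT multipliers at efficient solutions\<close>

theorem theorem6:
  fixes p :: nat
    and f :: "nat \<Rightarrow> real ^ 'n \<Rightarrow> real"
    and T :: "'t set"
    and g :: "'t \<Rightarrow> real ^ 'n \<Rightarrow> ereal"
    and xh :: "real ^ 'n"
  assumes "p \<ge> 2"
    and "\<And>i. i \<in> {1..p} \<Longrightarrow> convex_on UNIV (f i)"
    and "infinite T"
    and "\<And>t. t \<in> T \<Longrightarrow> lsc (g t) \<and> proper (g t) \<and> convex_ereal (g t)"
    and "feasible T g \<noteq> {}"
    and "efficient p f T g xh"
    and "EADQ p f T g xh"
    and "MOQ p f xh"
  shows "strong_KKT p f T g xh"
proof (rule family_cone_UNIV_imp_strong_KKT)
  let ?A = "case_sum (\<lambda>i. subdiff_real (f i) xh) (\<lambda>t. subdiff (g t) xh)"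
  show "1 \<le> p" using \<open>p \<ge> 2\<close> by simp
  show "subdiff_real (f i) xh \<noteq> {}" if "i \<in> {1..p}" for i
    using assms(2)[OF that] by (rule subdiff_real_nonempty)
  show "family_cone ?A ({1..p} <+> active T g xh) = UNIV"
  proof (rule family_cone_eq_UNIV)
    show "convex (?A j)" for j
      by (cases j) (simp_all add: convex_subdiff)
    have "(\<Union>j\<in>{1..p} <+> active T g xh. ?A j) = F_set p f xh \<union> G_set T g xh"
      by (auto simp: F_set_def G_set_def Plus_def)
    moreover have "polar (F_set p f xh \<union> G_set T g xh)
        = polar (F_set p f xh) \<inter> polar (G_set T g xh)"
      by (auto simp: polar_def)
    ultimately show "polar (\<Union>j\<in>{1..p} <+> active T g xh. ?A j) \<subseteq> {0}"
      using efficient_imp_polars_trivial[OF assms(2,6,7,8)] by simp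
  qed
qed

end
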